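(* Let $p$ be a positive integer such that $p\equiv 3\pmod 4$, and let $H$ be a balancedly multi-splittable $p^2\times p(p+1)$ partial Hadamard matrix. (i) There exist signed permutation matrices $P$ of order $p^2$ and $Q$ of order $p(p+1)$ such that $H':=PHQ$ is row-regular and column-regular. (ii) $H'$ is embeddable in a Hadamard matrix of order $p(p+1)$.
   Context: An $m\times n$ partial Hadamard matrix is an $m\times n$ matrix $H$ with entries in $\{1,-1\}$ such that $HH^\top=nI_m$; a Hadamard matrix of order $n$ is an $n\times n$ partial Hadamard matrix. For $p\equiv 3\pmod 4$, a $p^2\times p(p+1)$ partial Hadamard matrix $H$ is balancedly multi-splittable if it can be put in a block form $H=[H_1\ \cdots\ H_{p+1}]$ (a partition of its columns), each $H_i$ being a $p^2\times p$ matrix, such that for every $(p+1)/2$-element subset $\{i_1,\ldots,i_{(p+1)/2}\}$ of $\{1,\ldots,p+1\}$, with $K=[H_{i_1}\ \cdots\ H_{i_{(p+1)/2}}]$, all off-diagonal entries of $KK^\top$ lie in $\{\frac{p+1}{2},-\frac{p+1}{2}\}$. A signed permutation matrix is a square matrix with entries in $\{0,1,-1\}$ having exactly one nonzero entry in each row and each column. A matrix is row-regular (resp. column-regular) if all its row sums (resp. all its column sums) are equal. A $p^2\times p(p+1)$ matrix $H'$ is embeddable in a Hadamard matrix of order $p(p+1)$ if there is a $p\times p(p+1)$ matrix $M$ such that $\begin{bmatrix}H'\\ M\end{bmatrix}$ is a Hadamard matrix of order $p(p+1)$. *)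

theory Defs
  imports
    "Jordan_Normal_Form.DL_Submatrix"
    "HOL-Library.Disjoint_Sets"
    "HOL-Number_Theory.Cong"
begin

definition partial_hadamard_mat :: "nat \<Rightarrow> nat \<Rightarrow> int mat \<Rightarrow> bool" where
  "partial_hadamard_mat m n H \<longleftrightarrow>
     H \<in> carrier_mat m n \<and> elements_mat H \<subseteq> {1, -1} \<and>
     H * transpose_mat H = int n \<cdot>\<^sub>m 1\<^sub>m m"

abbreviation hadamard_mat :: "nat \<Rightarrow> int mat \<Rightarrow> bool" where
  "hadamard_mat n H \<equiv> partial_hadamard_mat n n H"

definition columns_submat :: "'a mat \<Rightarrow> nat set \<Rightarrow> 'a mat" where
  "columns_submat H J = submatrix H UNIV J"

(* C i is the set of column indices (counted from 0) of the block H_i, for i in {1..p+1}; the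
   blocks need not consist of consecutive columns of H. The columns of K are kept in the order they
   have in H, instead of being grouped by blocks; the product K K^T does not depend on this order.
   The division by 2 is exact for odd p. *)
definition balancedly_multi_splittable :: "nat \<Rightarrow> int mat \<Rightarrow> bool" where
  "balancedly_multi_splittable p H \<longleftrightarrow>
     (\<exists>C :: nat \<Rightarrow> nat set.
        disjoint_family_on C {1..p + 1} \<and>
        (\<Union>i\<in>{1..p + 1}. C i) = {..<dim_col H} \<and>
        (\<forall>i\<in>{1..p + 1}. card (C i) = p) \<and>
        (\<forall>I. I \<subseteq> {1..p + 1} \<and> card I = (p + 1) div 2 \<longrightarrow>
           (let K = columns_submat H (\<Union>i\<in>I. C i) in
              \<forall>a < dim_row H. \<forall>b < dim_row H. a \<noteq> b \<longrightarrow>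
                (K * transpose_mat K) $$ (a, b) \<in> {int ((p + 1) div 2), - int ((p + 1) div 2)})))"

definition signed_permutation_mat :: "nat \<Rightarrow> int mat \<Rightarrow> bool" where
  "signed_permutation_mat n P \<longleftrightarrow>
     P \<in> carrier_mat n n \<and> elements_mat P \<subseteq> {0, 1, -1} \<and>
     (\<forall>i<n. \<exists>!j. j < n \<and> P $$ (i, j) \<noteq> 0) \<and>
     (\<forall>j<n. \<exists>!i. i < n \<and> P $$ (i, j) \<noteq> 0)"

definition row_regular :: "int mat \<Rightarrow> bool" where
  "row_regular A \<longleftrightarrow> (\<exists>s. \<forall>i<dim_row A. (\<Sum>j<dim_col A. A $$ (i, j)) = s)"

definition column_regular :: "int mat \<Rightarrow> bool" where
  "column_regular A \<longleftrightarrow> (\<exists>s. \<forall>j<dim_col A. (\<Sum>i<dim_row A. A $$ (i, j)) = s)"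

(* Meant for matrices A of size p^2 x p(p+1). *)
definition embeddable_in_hadamard :: "nat \<Rightarrow> int mat \<Rightarrow> bool" where
  "embeddable_in_hadamard p A \<longleftrightarrow>
     (\<exists>M \<in> carrier_mat p (p * (p + 1)). hadamard_mat (p * (p + 1)) (A @\<^sub>r M))"

end

theory Submission
  imports Defs
begin

text \<open>
  Write \<open>x\<^sub>i(a, b)\<close> for the inner product of the rows \<open>a\<close> and \<open>b\<close> of \<open>H\<close> restricted to the block \<open>H\<^sub>i\<close>.
  For \<open>a \<noteq> b\<close> these \<open>p + 1\<close> integers add up to \<open>0\<close>, and every half of them adds up to
  \<open>(p + 1)/2\<close> or its negative. Exchanging single summands shows that this forces one of them to be
  \<open>s * p\<close> and all others to be \<open>- s\<close>, for a sign \<open>s = s(a, b)\<close>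
  (\<open>half_sums_determine_values\<close>). So any two rows are parallel in exactly one block, as two points of
  an affine plane lie on exactly one line of exactly one parallel class.

  If \<open>a\<close> and \<open>b\<close> are parallel in block \<open>i\<close>, then \<open>x\<^sub>i(a, c) = s(a, b) * x\<^sub>i(b, c)\<close>; comparing signs gives
  \<open>s(a, c) = s(a, b) * s(b, c)\<close> (\<open>pair_sign_trans\<close>). Hence the signs come from the rows: after
  negating some rows, parallel rows are equal in their common block and all other block inner
  products are \<open>-1\<close> (\<open>normalization\<close>).

  A class of \<open>c\<close> mutually parallel rows in one block has Gram matrix \<open>(p + 1) I - J\<close> in any other
  block, so \<open>c * (p + 1 - c)\<close> is a sum of squares and \<open>c \<le> p + 1\<close>; for \<open>c = p + 1\<close> the class adds up
  to zero in all other blocks, which contradicts the orthogonality to a row outside of the class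
  (\<open>card_class_le\<close>). As the classes of a row have \<open>p (p + 1)\<close> elements altogether, every class has
  exactly \<open>p\<close> elements. Therefore every column sum of the normalized rows is \<open>p\<close> times an odd number.
  The squares of the column sums of a block add up to \<open>p\<^sup>3\<close>, so each column sum is \<open>p\<close> or \<open>- p\<close>
  (\<open>column_sign_values\<close>). Negating the columns with sum \<open>- p\<close> makes all column sums equal to \<open>p\<close> and
  all row sums inside a block equal to \<open>1\<close> (\<open>block_row_sum\<close>). This proves part (i) with diagonal
  \<open>P\<close> and \<open>Q\<close>.

  For part (ii), a matrix \<open>M\<close> that is, up to the column signs, constant on each block is orthogonal to
  the rows of \<open>H\<close> as soon as its block values add up to \<open>0\<close> in each row, because the block sums of
  the normalized rows are all equal. The block values are taken from a \<open>p \<times> (p + 1)\<close> matrix, which is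
  a Hadamard matrix of order \<open>p + 1\<close> without its constant row, and such a matrix is found inside \<open>H\<close>:
  restrict a class of parallel rows to another block, and append a column of entries \<open>-1\<close>
  (\<open>companion_rows\<close>). So \<open>H\<close> itself is embeddable, and if \<open>M\<close> completes \<open>H\<close> then \<open>M * Q\<close> completes
  \<open>P * H * Q\<close>.
\<close>


section \<open>Integers whose half sums have constant absolute value\<close>

text \<open>Complete \<open>U\<close> and \<open>V\<close> by the same set to subsets of size \<open>q\<close>: the difference of the sums over \<open>U\<close> and
  \<open>V\<close> is then a difference of two half sums.\<close>

lemma exchange_difference:
  fixes x :: "'b \<Rightarrow> int" and q :: nat
  assumes "finite B" "card B = 2 * q"
    and half: "\<And>I. I \<subseteq> B \<Longrightarrow> card I = q \<Longrightarrow> sum x I \<in> {int q, - int q}"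
    and U: "U \<subseteq> B" and V: "V \<subseteq> B" and "U \<inter> V = {}" "card U = card V" "card U \<le> q"
  shows "sum x U - sum x V \<in> {0, 2 * int q, - 2 * int q}"
proof -
  have fin: "finite U" "finite V"
    using U V \<open>finite B\<close> by (auto intro: finite_subset)
  have "card (B - (U \<union> V)) = 2 * q - 2 * card U"
    using assms fin by (simp add: card_Diff_subset card_Un_disjoint)
  then have "q - card U \<le> card (B - (U \<union> V))"
    using \<open>card U \<le> q\<close> by simp
  then obtain T where T: "T \<subseteq> B - (U \<union> V)" "card T = q - card U"
    by (meson obtain_subset_with_card_n)
  have finT: "finite T"
    using T(1) \<open>finite B\<close> by (meson finite_Diff finite_subset)
  have "T \<inter> U = {}" "T \<inter> V = {}"
    using T(1) by auto
  then have "sum x (T \<union> U) = sum x T + sum x U" "sum x (T \<union> V) = sum x T + sum x V"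
    "card (T \<union> U) = q" "card (T \<union> V) = q"
    using finT fin T(2) assms(7,8) by (simp_all add: sum.union_disjoint card_Un_disjoint)
  moreover have "T \<union> U \<subseteq> B" "T \<union> V \<subseteq> B"
    using T(1) U V by auto
  ultimately show ?thesis
    using half[of "T \<union> U"] half[of "T \<union> V"] by auto
qed

text \<open>By exchanging single elements, two values differ by \<open>0\<close> or \<open>2 q\<close>, so there are at most two
  values. They cannot both occur twice, since exchanging two large for two small values would change
  a half sum by \<open>4 q\<close>. So one value is isolated, and the total \<open>0\<close> determines both values.\<close>

lemma half_sums_determine_values:
  fixes x :: "'b \<Rightarrow> int" and q :: nat
  assumes "finite B" and cardB: "card B = 2 * q" and "2 \<le> q" and zero: "sum x B = 0"
    and half: "\<And>I. I \<subseteq> B \<Longrightarrow> card I = q \<Longrightarrow> sum x I \<in> {int q, - int q}"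
  obtains i s where "i \<in> B" "s \<in> {1, -1}" "x i = s * (2 * int q - 1)"
    "\<And>k. k \<in> B \<Longrightarrow> k \<noteq> i \<Longrightarrow> x k = - s"
proof -
  have diff1: "x i - x j \<in> {0, 2 * int q, - 2 * int q}" if "i \<in> B" "j \<in> B" for i j
  proof (cases "i = j")
    case False
    then show ?thesis
      using exchange_difference[OF assms(1,2) half, of "{i}" "{j}"] that \<open>2 \<le> q\<close> by simp
  qed simp
  have rest: "sum x (B - {i}) = - x i" if "i \<in> B" for i
    using zero sum.remove[OF \<open>finite B\<close> that, of x] by simp
  \<comment> \<open>Both shapes below have all values but one equal to a constant, and the total fixes that constant.\<close>
  have const: "x i = s * (2 * int q - 1) \<and> c = - s"
    if "i \<in> B" "\<And>k. k \<in> B \<Longrightarrow> k \<noteq> i \<Longrightarrow> x k = c" "x i = c + s * (2 * int q)" for i c s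
  proof -
    have "sum x (B - {i}) = (2 * int q - 1) * c"
      using that(1,2) \<open>finite B\<close> cardB \<open>2 \<le> q\<close> by (simp add: of_nat_diff)
    then have "(2 * int q) * (c + s) = 0"
      using rest[OF that(1)] that(3) by (simp add: algebra_simps)
    then have "c = - s"
      using \<open>2 \<le> q\<close> by simp
    with that(3) show ?thesis
      by (simp add: algebra_simps)
  qed
  have "\<exists>i\<in>B. \<exists>j\<in>B. x i \<noteq> x j"
  proof (rule ccontr)
    assume *: "\<not> ?thesis"
    obtain I where I: "I \<subseteq> B" "card I = q"
      using obtain_subset_with_card_n[of q B] cardB by auto
    from I \<open>2 \<le> q\<close> obtain i where "i \<in> B"
      by fastforce
    with * have eq: "x k = x i" if "k \<in> B" for k
      using that by blast
    have "(\<Sum>k\<in>B. x k) = (\<Sum>k\<in>B. x i)"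
      by (rule sum.cong) (use eq in auto)
    then have "2 * int q * x i = 0"
      using zero cardB by simp
    then have "x i = 0"
      using \<open>2 \<le> q\<close> by simp
    then have "sum x I = 0"
      using eq I by (intro sum.neutral) auto
    with half[OF I] \<open>2 \<le> q\<close> show False
      by auto
  qed
  then obtain i j where ij: "i \<in> B" "j \<in> B" "x j < x i"
    by (metis linorder_neqE)
  then have gap: "x i = x j + 2 * int q"
    using diff1[of i j] by auto
  have two: "x k = x i \<or> x k = x j" if "k \<in> B" for k
    using diff1[OF that \<open>i \<in> B\<close>] diff1[OF that \<open>j \<in> B\<close>] gap \<open>2 \<le> q\<close> by auto
  show ?thesis
  proof (cases "\<forall>k\<in>B. k \<noteq> i \<longrightarrow> x k = x j")
    case True
    then show ?thesis
      using const[of i "x j" 1] that[of i 1] gap ij by auto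
  next
    case False
    then obtain k where k: "k \<in> B" "k \<noteq> i" "x k = x i"
      using two by blast
    have large: "x l = x i" if l: "l \<in> B" "l \<noteq> j" for l
    proof (rule ccontr)
      assume "x l \<noteq> x i"
      with two l have "x l = x j" by blast
      with k l ij have "{i, k} \<inter> {l, j} = {}" "card {i, k} = card {l, j}" "card {i, k} \<le> q"
        "{i, k} \<subseteq> B" "{l, j} \<subseteq> B"
        using \<open>2 \<le> q\<close> by auto
      \<comment> \<open>Exchanging two large values for two small ones changes a half sum by twice the gap.\<close>
      then have "sum x {i, k} - sum x {l, j} \<in> {0, 2 * int q, - 2 * int q}"
        by (intro exchange_difference[OF assms(1,2)] half)
      moreover have "sum x {i, k} - sum x {l, j} = 4 * int q"
        using k l ij gap \<open>x l = x j\<close> by simp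
      ultimately show False
        using \<open>2 \<le> q\<close> by auto
    qed
    then have "x j = (-1) * (2 * int q - 1) \<and> x i = - (-1)"
      using gap by (intro const ij) auto
    with large show ?thesis
      by (intro that[of j "-1"] ij) auto
  qed
qed

section \<open>Sign rows cut into blocks\<close>

definition block_inner :: "('b \<Rightarrow> 'c set) \<Rightarrow> ('r \<Rightarrow> 'c \<Rightarrow> int) \<Rightarrow> 'b \<Rightarrow> 'r \<Rightarrow> 'r \<Rightarrow> int" where
  "block_inner C h i a b = (\<Sum>j\<in>C i. h a j * h b j)"

lemma sign_sum_extreme:
  fixes f :: "'c \<Rightarrow> int"
  assumes "finite A" "\<And>j. j \<in> A \<Longrightarrow> f j \<in> {1, -1}" "s \<in> {1, -1}" "sum f A = s * int (card A)" "j \<in> A"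
  shows "f j = s"
proof -
  have "(\<Sum>j\<in>A. 1 - s * f j) = 0"
    using assms(3,4) by (auto simp: sum_subtractf simp flip: sum_distrib_left)
  moreover have "0 \<le> 1 - s * f j" if "j \<in> A" for j
    using assms(2)[OF that] assms(3) by auto
  ultimately have "1 - s * f j = 0"
    using assms(1,5) by (simp add: sum_nonneg_eq_0_iff)
  then show ?thesis
    using assms(2)[OF assms(5)] assms(3) by auto
qed

locale sign_blocks =
  fixes p :: nat and R :: "'r set" and B :: "'b set" and C :: "'b \<Rightarrow> 'c set" and h :: "'r \<Rightarrow> 'c \<Rightarrow> int"
  assumes p_odd: "odd p" and p_ge: "3 \<le> p"
    and card_rows: "card R = p^2"
    and card_blocks: "card B = p + 1"
    and card_block: "i \<in> B \<Longrightarrow> card (C i) = p"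
    and entry: "a \<in> R \<Longrightarrow> i \<in> B \<Longrightarrow> j \<in> C i \<Longrightarrow> h a j \<in> {1, -1}"
begin

abbreviation inner :: "'b \<Rightarrow> 'r \<Rightarrow> 'r \<Rightarrow> int" where
  "inner \<equiv> block_inner C h"

lemma finite_rows: "finite R"
  using card_rows p_ge by (intro card_ge_0_finite) simp

lemma finite_blocks: "finite B"
  using card_blocks by (intro card_ge_0_finite) simp

lemma finite_block: "i \<in> B \<Longrightarrow> finite (C i)"
  using card_block p_ge by (intro card_ge_0_finite) simp

lemma entry_sq: "a \<in> R \<Longrightarrow> i \<in> B \<Longrightarrow> j \<in> C i \<Longrightarrow> h a j * h a j = 1"
  using entry by fastforce

lemma inner_self: "a \<in> R \<Longrightarrow> i \<in> B \<Longrightarrow> inner i a a = int p"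
  using entry_sq card_block by (simp add: block_inner_def)

lemma inner_commute: "inner i a b = inner i b a"
  by (simp add: block_inner_def mult.commute)

lemma inner_extreme:
  assumes "a \<in> R" "b \<in> R" "i \<in> B" "s \<in> {1, -1}" "inner i a b = s * int p" "j \<in> C i"
  shows "h a j = s * h b j"
proof -
  have "h a k * h b k \<in> {1, -1}" if "k \<in> C i" for k
    using entry[OF \<open>a \<in> R\<close> \<open>i \<in> B\<close> that] entry[OF \<open>b \<in> R\<close> \<open>i \<in> B\<close> that] by auto
  moreover have "(\<Sum>k\<in>C i. h a k * h b k) = s * int (card (C i))"
    using assms(3,5) card_block by (simp add: block_inner_def)
  ultimately have "h a j * h b j = s"
    using sign_sum_extreme[OF finite_block[OF \<open>i \<in> B\<close>], of "\<lambda>k. h a k * h b k" s j] assms(4,6)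
    by blast
  then show ?thesis
    using entry_sq[OF \<open>b \<in> R\<close> \<open>i \<in> B\<close> \<open>j \<in> C i\<close>] by (metis mult.assoc mult.right_neutral)
qed

end

text \<open>The situation after suitable negations of rows. A row is parallel to another one in a block when
  they agree there, which means that their inner product is \<open>p\<close>.\<close>

locale normalized_sign_blocks = sign_blocks +
  assumes inner_values: "a \<in> R \<Longrightarrow> b \<in> R \<Longrightarrow> i \<in> B \<Longrightarrow> inner i a b \<in> {int p, -1}"
    and unique_parallel: "a \<in> R \<Longrightarrow> b \<in> R \<Longrightarrow> a \<noteq> b \<Longrightarrow> \<exists>!i. i \<in> B \<and> inner i a b = int p"

section \<open>Normalizing the signs of the rows\<close>

locale balanced_sign_blocks = sign_blocks +
  assumes orthogonal: "a \<in> R \<Longrightarrow> b \<in> R \<Longrightarrow> a \<noteq> b \<Longrightarrow> (\<Sum>i\<in>B. inner i a b) = 0"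
    and half_sums: "a \<in> R \<Longrightarrow> b \<in> R \<Longrightarrow> a \<noteq> b \<Longrightarrow> I \<subseteq> B \<Longrightarrow> card I = (p + 1) div 2 \<Longrightarrow>
      (\<Sum>i\<in>I. inner i a b) \<in> {int ((p + 1) div 2), - int ((p + 1) div 2)}"
begin

text \<open>The inner products of two rows in the \<open>p + 1\<close> blocks satisfy the hypotheses of
  \<open>half_sums_determine_values\<close> with \<open>q = (p + 1) / 2\<close>.\<close>

lemma inner_pattern:
  assumes "a \<in> R" "b \<in> R" "a \<noteq> b"
  obtains i s where "i \<in> B" "s \<in> {1, -1}" "inner i a b = s * int p"
    "\<And>k. k \<in> B \<Longrightarrow> k \<noteq> i \<Longrightarrow> inner k a b = - s"
proof -
  have q: "p + 1 = 2 * ((p + 1) div 2)" "2 \<le> (p + 1) div 2"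
    using p_odd p_ge by auto
  then have eq: "2 * int ((p + 1) div 2) - 1 = int p"
    by linarith
  have "card B = 2 * ((p + 1) div 2)"
    using card_blocks q(1) by simp
  obtain i s where "i \<in> B" "s \<in> {1, -1}" "inner i a b = s * (2 * int ((p + 1) div 2) - 1)"
    "\<And>k. k \<in> B \<Longrightarrow> k \<noteq> i \<Longrightarrow> inner k a b = - s"
    by (rule half_sums_determine_values[OF finite_blocks \<open>card B = _\<close> q(2) orthogonal[OF assms]
          half_sums[OF assms]]) blast+
  then show ?thesis
    unfolding eq by (rule that)
qed

text \<open>The sign \<open>s\<close> of \<open>inner_pattern\<close>: as \<open>p \<noteq> 1\<close>, the value \<open>p\<close> occurs among \<open>s * p\<close> and \<open>- s\<close> only
  for \<open>s = 1\<close>. This formula also gives the value \<open>1\<close> for a row and itself.\<close>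

definition pair_sign :: "'a \<Rightarrow> 'a \<Rightarrow> int" where
  "pair_sign a b = (if \<exists>i\<in>B. inner i a b = int p then 1 else -1)"

lemma pair_sign_self: "a \<in> R \<Longrightarrow> pair_sign a a = 1"
proof -
  assume "a \<in> R"
  have "B \<noteq> {}"
    using card_blocks by auto
  with \<open>a \<in> R\<close> show ?thesis
    using inner_self by (auto simp: pair_sign_def)
qed

lemma pair_sign_commute: "pair_sign a b = pair_sign b a"
  by (simp add: pair_sign_def inner_commute)

lemma pair_sign_eq:
  assumes "a \<in> R" "b \<in> R" "a \<noteq> b"
  obtains i where "i \<in> B" "inner i a b = pair_sign a b * int p"
    "\<And>k. k \<in> B \<Longrightarrow> k \<noteq> i \<Longrightarrow> inner k a b = - pair_sign a b"
proof -
  obtain i s where pat: "i \<in> B" "s \<in> {1, -1}" "inner i a b = s * int p"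
    "\<And>k. k \<in> B \<Longrightarrow> k \<noteq> i \<Longrightarrow> inner k a b = - s"
    by (rule inner_pattern[OF assms]) blast
  have "pair_sign a b = s"
  proof (cases "s = 1")
    case True
    then show ?thesis
      using pat by (auto simp: pair_sign_def)
  next
    case False
    then have "s = -1" using pat(2) by auto
    then have "inner k a b \<noteq> int p" if "k \<in> B" for k
      using pat that p_ge by (cases "k = i") auto
    then show ?thesis
      using \<open>s = -1\<close> by (auto simp: pair_sign_def)
  qed
  then show ?thesis
    using pat by (intro that[of i]) auto
qed

lemma pair_sign_values: "pair_sign a b \<in> {1, -1}"
  by (simp add: pair_sign_def)

lemma inner_values_signed:
  assumes "a \<in> R" "b \<in> R" "i \<in> B"
  shows "inner i a b \<in> {pair_sign a b * int p, - pair_sign a b}"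
proof (cases "a = b")
  case True
  then show ?thesis
    using assms by (simp add: inner_self pair_sign_self)
next
  case False
  obtain k where k: "inner k a b = pair_sign a b * int p"
    "\<And>l. l \<in> B \<Longrightarrow> l \<noteq> k \<Longrightarrow> inner l a b = - pair_sign a b"
    by (rule pair_sign_eq[OF assms(1,2) False]) blast
  show ?thesis
    using k(1) k(2)[OF \<open>i \<in> B\<close>] by (cases "i = k") simp_all
qed

text \<open>In the block where \<open>a\<close> and \<open>b\<close> are parallel, the inner products with \<open>c\<close> differ by the factor
  \<open>pair_sign a b\<close>, and both have the form \<open>s * p\<close> or \<open>- s\<close> with the sign \<open>s\<close> in question. The same
  alternative holds for both, as \<open>p \<noteq> 1\<close>.\<close>

lemma pair_sign_trans:
  assumes "a \<in> R" "b \<in> R" "c \<in> R"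
  shows "pair_sign a c = pair_sign a b * pair_sign b c"
proof (cases "a = b")
  case True
  then show ?thesis
    using assms pair_sign_self by simp
next
  case False
  obtain i where i: "i \<in> B" "inner i a b = pair_sign a b * int p"
    by (rule pair_sign_eq[OF assms(1,2) False]) blast
  have "h a j = pair_sign a b * h b j" if "j \<in> C i" for j
    by (rule inner_extreme[OF assms(1,2) i(1) pair_sign_values i(2) that])
  then have eq: "inner i a c = pair_sign a b * inner i b c"
    by (simp add: block_inner_def sum_distrib_left mult.assoc)
  show ?thesis
    using inner_values_signed[OF assms(1,3) i(1)] inner_values_signed[OF assms(2,3) i(1)] eq p_ge
      pair_sign_values[of a b] pair_sign_values[of b c] pair_sign_values[of a c]
    by auto
qed

text \<open>By \<open>pair_sign_trans\<close>, the signs relative to a fixed row \<open>r\<close> split \<open>pair_sign\<close> as a product of row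
  signs.\<close>

lemma normalization:
  assumes "r \<in> R"
  shows "normalized_sign_blocks p R B C (\<lambda>a j. pair_sign a r * h a j)"
proof -
  have inner: "block_inner C (\<lambda>a j. pair_sign a r * h a j) i a b = pair_sign a b * inner i a b"
    if "a \<in> R" "b \<in> R" for i a b
  proof -
    have "pair_sign a r * h a j * (pair_sign b r * h b j) = pair_sign a b * (h a j * h b j)" for j
      unfolding pair_sign_trans[OF that(1) assms that(2)] pair_sign_commute[of b r]
      by (simp only: mult_ac)
    then show ?thesis
      by (simp only: block_inner_def sum_distrib_left)
  qed
  show ?thesis
  proof unfold_locales
    fix a i j assume "a \<in> R" "i \<in> B" "j \<in> C i"
    then show "pair_sign a r * h a j \<in> {1, -1}"
      using entry[of a i j] pair_sign_values[of a r] by auto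
  next
    fix a b i assume *: "a \<in> R" "b \<in> R" "i \<in> B"
    then show "block_inner C (\<lambda>a j. pair_sign a r * h a j) i a b \<in> {int p, -1}"
      using inner_values_signed[OF *] pair_sign_values[of a b] by (auto simp: inner)
  next
    fix a b assume *: "a \<in> R" "b \<in> R" "a \<noteq> b"
    obtain i where i: "i \<in> B" "inner i a b = pair_sign a b * int p"
      "\<And>k. k \<in> B \<Longrightarrow> k \<noteq> i \<Longrightarrow> inner k a b = - pair_sign a b"
      by (rule pair_sign_eq[OF *]) blast
    have "pair_sign a b * inner i a b = int p"
      "\<And>k. k \<in> B \<Longrightarrow> k \<noteq> i \<Longrightarrow> pair_sign a b * inner k a b = - 1"
      using i pair_sign_values[of a b] by auto
    then show "\<exists>!i. i \<in> B \<and> block_inner C (\<lambda>a j. pair_sign a r * h a j) i a b = int p"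
      using i(1) * by (intro ex1I[of _ i]) (auto simp: inner, force)
  qed (use p_odd p_ge card_rows card_blocks card_block in auto)
qed

end

section \<open>Parallel classes and column sums of normalized rows\<close>

context normalized_sign_blocks
begin

definition parallel_class where
  "parallel_class i a = {b \<in> R. inner i a b = int p}"

lemma finite_class: "finite (parallel_class i a)"
  using finite_rows by (simp add: parallel_class_def)

lemma parallel_entries:
  assumes "a \<in> R" "b \<in> R" "i \<in> B" "inner i a b = int p" "j \<in> C i"
  shows "h a j = h b j"
  using inner_extreme[OF assms(1-3), of 1 j] assms(4,5) by simp

lemma parallel_inner_cong:
  assumes "a \<in> R" "b \<in> R" "i \<in> B" "inner i a b = int p"
  shows "inner i a c = inner i b c"
  unfolding block_inner_def by (rule sum.cong) (simp_all add: parallel_entries[OF assms])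

lemma inner_not_parallel:
  assumes "a \<in> R" "b \<in> R" "i \<in> B" "inner i a b \<noteq> int p"
  shows "inner i a b = -1"
  using inner_values[OF assms(1-3)] assms(4) by simp

lemma inner_other_block:
  assumes "a \<in> R" "b \<in> R" "a \<noteq> b" "i \<in> B" "inner i a b = int p" "k \<in> B" "k \<noteq> i"
  shows "inner k a b = -1"
  using unique_parallel[OF assms(1-3)] assms by (intro inner_not_parallel) auto

lemma rows_orthogonal:
  assumes "a \<in> R" "b \<in> R" "a \<noteq> b"
  shows "(\<Sum>i\<in>B. inner i a b) = 0"
proof -
  obtain i where i: "i \<in> B" "inner i a b = int p"
    using unique_parallel[OF assms] by auto
  have "(\<Sum>k\<in>B - {i}. inner k a b) = (\<Sum>k\<in>B - {i}. -1)"
    using inner_other_block[OF assms i] by (intro sum.cong) auto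
  also have "\<dots> = - int p"
    using i(1) card_blocks finite_blocks by simp
  finally show ?thesis
    using i finite_blocks by (simp add: sum.remove[OF finite_blocks i(1)])
qed

lemma class_inner:
  assumes "a \<in> R" "i \<in> B" "k \<in> B" "k \<noteq> i" "b \<in> parallel_class i a" "c \<in> parallel_class i a"
  shows "inner k b c = (if b = c then int p else -1)"
proof -
  have bc: "b \<in> R" "c \<in> R" "inner i a b = int p" "inner i a c = int p"
    using assms(5,6) by (auto simp: parallel_class_def)
  then have "inner i b c = int p"
    using parallel_inner_cong[OF assms(1) bc(1) assms(2)] by metis
  then show ?thesis
    using inner_other_block[OF bc(1,2) _ assms(2) _ assms(3,4)] inner_self[OF bc(1) assms(3)]
    by (cases "b = c") simp_all
qed

text \<open>By \<open>class_inner\<close>, the Gram matrix of the class in the block \<open>k\<close> is \<open>(p + 1) I - J\<close>. The two sides are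
  the sum of its entries.\<close>

lemma class_column_sums_sq:
  assumes "a \<in> R" "i \<in> B" "k \<in> B" "k \<noteq> i"
  shows "(\<Sum>j\<in>C k. (\<Sum>b\<in>parallel_class i a. h b j)\<^sup>2)
    = int (card (parallel_class i a)) * (int p + 1 - int (card (parallel_class i a)))"
proof -
  let ?L = "parallel_class i a"
  have "(\<Sum>j\<in>C k. (\<Sum>b\<in>?L. h b j)\<^sup>2) = (\<Sum>j\<in>C k. \<Sum>b\<in>?L. \<Sum>c\<in>?L. h b j * h c j)"
    by (simp add: power2_eq_square sum_product)
  also have "\<dots> = (\<Sum>b\<in>?L. \<Sum>j\<in>C k. \<Sum>c\<in>?L. h b j * h c j)"
    by (rule sum.swap)
  also have "\<dots> = (\<Sum>b\<in>?L. \<Sum>c\<in>?L. inner k b c)"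
    unfolding block_inner_def by (intro sum.cong refl sum.swap)
  also have "\<dots> = (\<Sum>b\<in>?L. \<Sum>c\<in>?L. (if b = c then int p + 1 else 0) - 1)"
    using class_inner[OF assms] by (intro sum.cong refl) simp
  also have "\<dots> = (\<Sum>b\<in>?L. int p + 1 - int (card ?L))"
    using finite_class by (intro sum.cong refl) (simp add: sum_subtractf)
  also have "\<dots> = int (card ?L) * (int p + 1 - int (card ?L))"
    by simp
  finally show ?thesis .
qed

text \<open>Positivity in \<open>class_column_sums_sq\<close> leaves only the size \<open>p + 1\<close> to be excluded. In that case the
  class adds up to the zero vector in every block other than \<open>i\<close>, while a row \<open>b\<close> outside of the class has
  inner product \<open>-1\<close> with each of its members in block \<open>i\<close>. So \<open>b\<close> could not be orthogonal to their
  sum.\<close>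

lemma card_class_le:
  assumes "a \<in> R" "i \<in> B"
  shows "card (parallel_class i a) \<le> p"
proof -
  let ?L = "parallel_class i a"
  have "card (B - {i}) = p"
    using card_blocks assms(2) by simp
  then have "B - {i} \<noteq> {}"
    using p_ge by (intro notI) simp
  then obtain k where k: "k \<in> B" "k \<noteq> i"
    by auto
  have "a \<in> ?L"
    using assms inner_self by (simp add: parallel_class_def)
  then have pos: "0 < card ?L"
    using finite_class card_gt_0_iff by blast
  have "0 \<le> int (card ?L) * (int p + 1 - int (card ?L))"
    unfolding class_column_sums_sq[OF assms k, symmetric] by (simp add: sum_nonneg)
  then have "card ?L \<le> p + 1"
    using pos by (simp add: zero_le_mult_iff)
  moreover have "card ?L \<noteq> p + 1"
  proof
    assume full: "card ?L = p + 1"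
    have "p + 1 < p * p"
      using p_ge mult_le_mono1[OF p_ge, of p] by linarith
    then have "\<not> R \<subseteq> ?L"
      using card_mono[OF finite_class, of R i a] full card_rows by (auto simp: power2_eq_square)
    then obtain b where b: "b \<in> R" "b \<notin> ?L"
      by blast
    have vanish: "(\<Sum>r\<in>?L. inner l b r) = 0" if l: "l \<in> B" "l \<noteq> i" for l
    proof -
      have "(\<Sum>j\<in>C l. (\<Sum>r\<in>?L. h r j)\<^sup>2) = 0"
        using class_column_sums_sq[OF assms l] full by simp
      then have zero: "(\<Sum>r\<in>?L. h r j) = 0" if "j \<in> C l" for j
        using that finite_block[OF l(1)] by (simp add: sum_nonneg_eq_0_iff)
      have "(\<Sum>r\<in>?L. inner l b r) = (\<Sum>j\<in>C l. h b j * (\<Sum>r\<in>?L. h r j))"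
        unfolding block_inner_def sum_distrib_left by (rule sum.swap)
      then show ?thesis
        using zero by simp
    qed
    have "inner i b r = -1" if "r \<in> ?L" for r
    proof (rule inner_not_parallel)
      show "inner i b r \<noteq> int p"
        using b that parallel_inner_cong[OF assms(1) _ assms(2), of r b] inner_commute[of i r b]
        by (auto simp: parallel_class_def)
    qed (use b assms that in \<open>auto simp: parallel_class_def\<close>)
    then have "(\<Sum>r\<in>?L. inner i b r) = - int (p + 1)"
      using full by simp
    then have "(\<Sum>l\<in>B. \<Sum>r\<in>?L. inner l b r) = - int (p + 1)"
      using vanish by (simp add: sum.remove[OF finite_blocks assms(2)])
    moreover have "(\<Sum>l\<in>B. \<Sum>r\<in>?L. inner l b r) = (\<Sum>r\<in>?L. \<Sum>l\<in>B. inner l b r)"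
      by (rule sum.swap)
    moreover have "\<dots> = 0"
      using b rows_orthogonal[OF b(1)] by (intro sum.neutral) (auto simp: parallel_class_def)
    ultimately show False
      by simp
  qed
  ultimately show ?thesis
    by simp
qed

text \<open>Each row other than \<open>a\<close> is counted in one block, and \<open>a\<close> is counted in all of them. Hence the bound
  \<open>card_class_le\<close> is attained on average, and so everywhere.\<close>

lemma sum_card_classes:
  assumes "a \<in> R"
  shows "(\<Sum>i\<in>B. card (parallel_class i a)) = (\<Sum>i\<in>B. p)"
proof -
  have "(\<Sum>i\<in>B. card (parallel_class i a)) = (\<Sum>i\<in>B. \<Sum>b\<in>R. if inner i a b = int p then 1 else 0)"
    using finite_rows by (simp add: parallel_class_def sum.If_cases Int_def)
  also have "\<dots> = (\<Sum>b\<in>R. \<Sum>i\<in>B. if inner i a b = int p then 1 else 0)"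
    by (rule sum.swap)
  also have "\<dots> = (\<Sum>b\<in>R. if b = a then p + 1 else 1)"
  proof (intro sum.cong refl)
    fix b assume b: "b \<in> R"
    show "(\<Sum>i\<in>B. if inner i a b = int p then 1 else 0) = (if b = a then p + 1 else 1)"
    proof (cases "b = a")
      case True
      then show ?thesis
        using inner_self[OF assms] card_blocks by simp
    next
      case False
      then obtain i where "{k \<in> B. inner k a b = int p} = {i}"
        using unique_parallel[OF assms b False[symmetric]] by blast
      with False show ?thesis
        using finite_blocks by (simp add: sum.If_cases Int_def)
    qed
  qed
  also have "\<dots> = p + 1 + (p\<^sup>2 - 1)"
    using finite_rows card_rows assms by (simp add: sum.remove[OF finite_rows assms])
  also have "\<dots> = (\<Sum>i\<in>B. p)"
    using p_ge card_blocks by (simp add: power2_eq_square)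
  finally show ?thesis .
qed

lemma card_class:
  assumes "a \<in> R" "i \<in> B"
  shows "card (parallel_class i a) = p"
  by (rule sum_mono_inv[OF sum_card_classes[OF assms(1)] _ assms(2) finite_blocks])
    (rule card_class_le[OF assms(1)])

definition column_sum where
  "column_sum j = (\<Sum>a\<in>R. h a j)"

lemma column_sum_eq:
  assumes "i \<in> B" "j \<in> C i"
  shows "column_sum j = 2 * int (card {a \<in> R. h a j = 1}) - int (p\<^sup>2)"
proof -
  have "column_sum j = (\<Sum>a\<in>R. (if h a j = 1 then 2 else 0) - 1)"
    unfolding column_sum_def using entry[OF _ assms] by (intro sum.cong) force+
  also have "\<dots> = 2 * int (card {a \<in> R. h a j = 1}) - int (p\<^sup>2)"
    using finite_rows card_rows by (simp add: sum_subtractf sum.If_cases Int_def)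
  finally show ?thesis .
qed

lemma odd_column_sum: "i \<in> B \<Longrightarrow> j \<in> C i \<Longrightarrow> odd (column_sum j)"
  using p_odd by (simp add: column_sum_eq)

text \<open>The rows with entry \<open>1\<close> in the column \<open>j\<close> form a union of parallel classes of the block of \<open>j\<close>, because
  parallel rows have the same entry there, and each class has \<open>p\<close> elements.\<close>

lemma dvd_column_sum:
  assumes "i \<in> B" "j \<in> C i"
  shows "int p dvd column_sum j"
proof -
  let ?A = "{a \<in> R. h a j = 1}"
  let ?r = "{(a, b) \<in> ?A \<times> ?A. inner i a b = int p}"
  have cls: "?r `` {a} = parallel_class i a" if "a \<in> ?A" for a
  proof -
    have "h b j = 1" if "b \<in> R" "inner i a b = int p" for b
      using parallel_entries[OF _ that(1) assms(1) that(2) assms(2)] \<open>a \<in> ?A\<close> by simp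
    with that show ?thesis
      by (auto simp: parallel_class_def)
  qed
  have eqv: "equiv ?A ?r"
  proof (rule equivI)
    show "refl_on ?A ?r"
      using assms(1) by (auto simp: refl_on_def inner_self)
    show "sym ?r"
      by (auto simp: sym_def inner_commute)
    show "trans ?r"
    proof (rule transI)
      fix a b c assume "(a, b) \<in> ?r" "(b, c) \<in> ?r"
      then show "(a, c) \<in> ?r"
        using parallel_inner_cong[of a b i c] assms(1) by simp
    qed
  qed auto
  have "p dvd card ?A"
  proof (rule equiv_imp_dvd_card[OF _ eqv])
    fix X assume "X \<in> ?A // ?r"
    then obtain a where "a \<in> ?A" "X = ?r `` {a}"
      by (rule quotientE)
    then show "p dvd card X"
      using cls[OF \<open>a \<in> ?A\<close>] card_class[OF _ assms(1), of a] by simp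
  qed (use finite_rows in simp)
  then show ?thesis
    by (simp add: column_sum_eq[OF assms] power2_eq_square)
qed

lemma sum_column_sum_row:
  assumes "a \<in> R" "i \<in> B"
  shows "(\<Sum>j\<in>C i. h a j * column_sum j) = int p"
proof -
  have "(\<Sum>j\<in>C i. h a j * column_sum j) = (\<Sum>b\<in>R. inner i a b)"
    unfolding column_sum_def block_inner_def sum_distrib_left by (rule sum.swap)
  also have "\<dots> = (\<Sum>b\<in>R. (if inner i a b = int p then int p + 1 else 0) - 1)"
    using inner_not_parallel[OF assms(1) _ assms(2)] by (intro sum.cong) auto
  also have "\<dots> = int (card (parallel_class i a)) * (int p + 1) - int (card R)"
    using finite_rows by (simp add: sum_subtractf sum.If_cases Int_def parallel_class_def)
  also have "\<dots> = int p"
    by (simp add: card_class[OF assms] card_rows power2_eq_square algebra_simps)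
  finally show ?thesis .
qed

lemma sum_column_sum_sq:
  assumes "i \<in> B"
  shows "(\<Sum>j\<in>C i. (column_sum j)\<^sup>2) = int p ^ 3"
proof -
  have "(\<Sum>j\<in>C i. (column_sum j)\<^sup>2) = (\<Sum>j\<in>C i. \<Sum>a\<in>R. h a j * column_sum j)"
    by (simp add: power2_eq_square flip: sum_distrib_right column_sum_def)
  also have "\<dots> = (\<Sum>a\<in>R. \<Sum>j\<in>C i. h a j * column_sum j)"
    by (rule sum.swap)
  also have "\<dots> = int p ^ 3"
    using assms card_rows by (simp add: sum_column_sum_row power2_eq_square power3_eq_cube)
  finally show ?thesis .
qed

definition column_sign where
  "column_sign j = column_sum j div int p"

lemma column_sum_sign: "i \<in> B \<Longrightarrow> j \<in> C i \<Longrightarrow> column_sum j = int p * column_sign j"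
  using dvd_column_sum by (simp add: column_sign_def)

text \<open>The quotients are nonzero integers, because the column sums are odd, and the \<open>p\<close> quotients of a block
  have squares with total \<open>p\<close>.\<close>

lemma column_sign_values:
  assumes "i \<in> B" "j \<in> C i"
  shows "column_sign j \<in> {1, -1}"
proof -
  have ge: "0 \<le> (column_sign l)\<^sup>2 - 1" if "l \<in> C i" for l
  proof -
    have "column_sign l \<noteq> 0"
      using odd_column_sum[OF assms(1) that] column_sum_sign[OF assms(1) that] by auto
    then have "0 < (column_sign l)\<^sup>2" by simp
    then show ?thesis by linarith
  qed
  have "(int p)\<^sup>2 * (\<Sum>l\<in>C i. (column_sign l)\<^sup>2) = (\<Sum>l\<in>C i. (column_sum l)\<^sup>2)"
    using column_sum_sign[OF assms(1)] by (simp add: sum_distrib_left power_mult_distrib)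
  then have "(int p)\<^sup>2 * (\<Sum>l\<in>C i. (column_sign l)\<^sup>2) = (int p)\<^sup>2 * int p"
    using sum_column_sum_sq[OF assms(1)] by (simp add: power2_eq_square power3_eq_cube)
  then have "(\<Sum>l\<in>C i. (column_sign l)\<^sup>2 - 1) = 0"
    using p_ge card_block[OF assms(1)] by (simp add: sum_subtractf)
  then have "(column_sign j)\<^sup>2 = 1"
    using ge finite_block[OF assms(1)] assms(2) by (simp add: sum_nonneg_eq_0_iff)
  then show ?thesis
    by (simp add: power2_eq_1_iff)
qed

lemma block_row_sum:
  assumes "a \<in> R" "i \<in> B"
  shows "(\<Sum>j\<in>C i. h a j * column_sign j) = 1"
proof -
  have "int p * (\<Sum>j\<in>C i. h a j * column_sign j) = (\<Sum>j\<in>C i. h a j * column_sum j)"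
    using column_sum_sign[OF assms(2)] by (simp add: sum_distrib_left mult_ac)
  then show ?thesis
    using sum_column_sum_row[OF assms] p_ge by simp
qed

text \<open>The rows \<open>N 0, \<dots>, N (p - 1)\<close> form a Hadamard matrix of order \<open>p + 1\<close> without its row of ones. They
  come from the \<open>p\<close> rows of a parallel class of a block \<open>m\<close>: in another block \<open>i\<close> these have inner
  products \<open>-1\<close> and, after applying the column signs, sum \<open>1\<close>. One more entry \<open>-1\<close> corrects both the inner
  products and the sums to \<open>0\<close>. This extra entry is put in the place of the block \<open>i\<close>, and the other
  \<open>p\<close> blocks are matched with the columns of \<open>i\<close>.\<close>

lemma companion_rows:
  obtains N :: "nat \<Rightarrow> 'b \<Rightarrow> int" where
    "\<And>k i. k < p \<Longrightarrow> i \<in> B \<Longrightarrow> N k i \<in> {1, -1}"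
    "\<And>k. k < p \<Longrightarrow> (\<Sum>i\<in>B. N k i) = 0"
    "\<And>k l. k < p \<Longrightarrow> l < p \<Longrightarrow> (\<Sum>i\<in>B. N k i * N l i) = (if k = l then int p + 1 else 0)"
proof -
  obtain a where a: "a \<in> R"
    using card_rows p_ge by (metis card.empty equals0I not_numeral_le_zero power_not_zero)
  obtain T where "T \<subseteq> B" "card T = 2"
    using obtain_subset_with_card_n[of 2 B] card_blocks p_ge by auto
  then obtain i m where im: "i \<in> B" "m \<in> B" "m \<noteq> i"
    by (auto simp: card_2_iff)
  let ?L = "parallel_class m a"
  obtain f where f: "bij_betw f {..<p} ?L"
    using ex_bij_betw_nat_finite[OF finite_class, of m a] card_class[OF a im(2)]
    by (auto simp: lessThan_atLeast0)
  have fL: "f k \<in> ?L" "f k \<in> R" if "k < p" for k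
    using bij_betwE[OF f] that by (auto simp: parallel_class_def)
  have "card (B - {i}) = card (C i)"
    using card_blocks card_block im finite_blocks by simp
  then obtain e where e: "bij_betw e (B - {i}) (C i)"
    using finite_same_card_bij[of "B - {i}" "C i"] finite_blocks finite_block[OF im(1)] by auto
  have eC: "e l \<in> C i" if "l \<in> B" "l \<noteq> i" for l
    using bij_betwE[OF e] that by auto
  define N where "N k l = (if l = i then -1 else h (f k) (e l) * column_sign (e l))" for k l
  show ?thesis
  proof (rule that[of N])
    fix k l assume "k < p" "l \<in> B"
    then show "N k l \<in> {1, -1}"
      using entry[OF fL(2) im(1) eC] column_sign_values[OF im(1) eC] unfolding N_def by fastforce
  next
    fix k assume k: "k < p"
    have "(\<Sum>l\<in>B - {i}. N k l) = (\<Sum>l\<in>B - {i}. h (f k) (e l) * column_sign (e l))"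
      by (intro sum.cong) (auto simp: N_def)
    also have "\<dots> = 1"
      using sum.reindex_bij_betw[OF e, of "\<lambda>j. h (f k) j * column_sign j"]
        block_row_sum[OF fL(2)[OF k] im(1)] by simp
    finally show "(\<Sum>l\<in>B. N k l) = 0"
      by (simp add: sum.remove[OF finite_blocks im(1)] N_def)
  next
    fix k l assume kl: "k < p" "l < p"
    have sq: "column_sign j * column_sign j = 1" if "j \<in> C i" for j
      using column_sign_values[OF im(1) that] by auto
    have "(\<Sum>t\<in>B - {i}. N k t * N l t) = (\<Sum>t\<in>B - {i}. h (f k) (e t) * h (f l) (e t))"
      using sq[OF eC] by (intro sum.cong) (auto simp: N_def mult_ac)
    also have "\<dots> = inner i (f k) (f l)"
      using sum.reindex_bij_betw[OF e, of "\<lambda>j. h (f k) j * h (f l) j"] by (simp add: block_inner_def)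
    also have "\<dots> = (if f k = f l then int p else -1)"
      using class_inner[OF a im(2,1)] im(3) fL kl by metis
    also have "(f k = f l) = (k = l)"
      using f kl by (auto simp: bij_betw_def inj_on_def)
    finally show "(\<Sum>t\<in>B. N k t * N l t) = (if k = l then int p + 1 else 0)"
      by (simp add: sum.remove[OF finite_blocks im(1)] N_def)
  qed
qed

end

section \<open>Partial Hadamard matrices and signed permutations\<close>

lemma partial_hadamard_mat_iff:
  "partial_hadamard_mat m n H \<longleftrightarrow>
    H \<in> carrier_mat m n \<and> (\<forall>a<m. \<forall>j<n. H $$ (a, j) \<in> {1, -1}) \<and>
    (\<forall>a<m. \<forall>b<m. (\<Sum>j<n. H $$ (a, j) * H $$ (b, j)) = (if a = b then int n else 0))"
proof (cases "H \<in> carrier_mat m n")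
  case True
  have "elements_mat H \<subseteq> {1, -1} \<longleftrightarrow> (\<forall>a<m. \<forall>j<n. H $$ (a, j) \<in> {1, -1})"
    using True elements_matI[OF True] by blast
  moreover have "H * transpose_mat H = int n \<cdot>\<^sub>m 1\<^sub>m m \<longleftrightarrow>
    (\<forall>a<m. \<forall>b<m. (\<Sum>j<n. H $$ (a, j) * H $$ (b, j)) = (if a = b then int n else 0))"
    using True by (auto simp: mat_eq_iff scalar_prod_def lessThan_atLeast0)
  ultimately show ?thesis
    using True by (simp add: partial_hadamard_mat_def)
qed (simp add: partial_hadamard_mat_def)

text \<open>\<open>pick J\<close> enumerates \<open>J\<close> in increasing order, so the columns of the submatrix are those with index
  in \<open>J\<close>, each once.\<close>

lemma columns_submat_gram:
  fixes H :: "int mat"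
  assumes H: "H \<in> carrier_mat m n" and J: "J \<subseteq> {..<n}" and ab: "a < m" "b < m"
  shows "(columns_submat H J * transpose_mat (columns_submat H J)) $$ (a, b)
    = (\<Sum>j\<in>J. H $$ (a, j) * H $$ (b, j))"
proof -
  have fin: "finite J"
    using J finite_subset by blast
  have cols: "{j. j < dim_col H \<and> j \<in> J} = J" and rows: "{i. i < dim_row H \<and> i \<in> UNIV} = {..<m}"
    using H J by auto
  have dims: "dim_row (columns_submat H J) = m" "dim_col (columns_submat H J) = card J"
    unfolding columns_submat_def dim_submatrix cols rows by simp_all
  have entry: "columns_submat H J $$ (i, k) = H $$ (i, pick J k)" if "i < m" "k < card J" for i k
    using submatrix_index[of i H UNIV k J] that unfolding columns_submat_def cols rows
    by (simp add: pick_UNIV)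
  have "J \<subseteq> pick J ` {..<card J}"
  proof
    fix j assume j: "j \<in> J"
    then have "card {a \<in> J. a < j} < card J"
      using fin by (intro psubset_card_mono) auto
    then show "j \<in> pick J ` {..<card J}"
      using pick_card_in_set[OF j] by (intro image_eqI[where x = "card {a \<in> J. a < j}"]) auto
  qed
  moreover from this have "card (pick J ` {..<card J}) = card J"
    using card_image_le[of "{..<card J}" "pick J"] card_mono[of "pick J ` {..<card J}" J] by simp
  ultimately have pick: "bij_betw (pick J) {..<card J} J"
    unfolding bij_betw_def by (intro conjI eq_card_imp_inj_on card_subset_eq[symmetric]) auto
  have "(columns_submat H J * transpose_mat (columns_submat H J)) $$ (a, b)
    = (\<Sum>k<card J. H $$ (a, pick J k) * H $$ (b, pick J k))"
    using ab dims entry by (simp add: scalar_prod_def lessThan_atLeast0)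
  also have "\<dots> = (\<Sum>j\<in>J. H $$ (a, j) * H $$ (b, j))"
    by (rule sum.reindex_bij_betw[OF pick])
  finally show ?thesis .
qed

lemma signed_permutation_mat_diag:
  assumes "\<And>i. i < n \<Longrightarrow> e i \<in> {1, -1}"
  shows "signed_permutation_mat n (mat_diag n e)"
proof -
  have ne: "e i \<noteq> 0" if "i < n" for i
    using assms[OF that] by auto
  have "elements_mat (mat_diag n e) \<subseteq> {0, 1, -1}"
    using assms by (force simp: mat_diag_def dest!: elements_matD split: if_splits)
  then show ?thesis
    unfolding signed_permutation_mat_def using ne
    by (auto simp: mat_diag_def intro!: ex1I split: if_splits)
qed

lemma signed_permutation_mat_transpose:
  assumes "signed_permutation_mat n P"
  shows "signed_permutation_mat n (transpose_mat P)"
proof -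
  have P: "P \<in> carrier_mat n n" and el: "elements_mat P \<subseteq> {0, 1, -1}"
    using assms by (auto simp: signed_permutation_mat_def)
  have "elements_mat (transpose_mat P) \<subseteq> elements_mat P"
    using P elements_matI[OF P] by (auto dest!: elements_matD)
  then have "elements_mat (transpose_mat P) \<subseteq> {0, 1, -1}"
    using el by (rule subset_trans)
  moreover have "(\<exists>!j. j < n \<and> transpose_mat P $$ (i, j) \<noteq> 0) \<longleftrightarrow> (\<exists>!j. j < n \<and> P $$ (j, i) \<noteq> 0)"
    "(\<exists>!j. j < n \<and> transpose_mat P $$ (j, i) \<noteq> 0) \<longleftrightarrow> (\<exists>!j. j < n \<and> P $$ (i, j) \<noteq> 0)"
    if "i < n" for i
    using P that by (intro arg_cong[where f = Ex1] ext; auto)+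
  ultimately show ?thesis
    using assms P unfolding signed_permutation_mat_def by simp
qed

lemma signed_permutation_mult_left:
  assumes "signed_permutation_mat n P"
  obtains \<sigma> s where "bij_betw \<sigma> {..<n} {..<n}" "\<And>i. i < n \<Longrightarrow> s i \<in> {1, -1::int}"
    "\<And>A m i j. A \<in> carrier_mat n m \<Longrightarrow> i < n \<Longrightarrow> j < m \<Longrightarrow> (P * A) $$ (i, j) = s i * A $$ (\<sigma> i, j)"
proof -
  have P: "P \<in> carrier_mat n n" and el: "elements_mat P \<subseteq> {0, 1, -1}"
    and row: "\<And>i. i < n \<Longrightarrow> \<exists>!j. j < n \<and> P $$ (i, j) \<noteq> 0"
    and col: "\<And>j. j < n \<Longrightarrow> \<exists>!i. i < n \<and> P $$ (i, j) \<noteq> 0"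
    using assms by (auto simp: signed_permutation_mat_def)
  obtain \<sigma> where \<sigma>: "\<And>i. i < n \<Longrightarrow> \<sigma> i < n \<and> P $$ (i, \<sigma> i) \<noteq> 0"
    using row by metis
  have zero: "P $$ (i, j) = 0" if "i < n" "j < n" "j \<noteq> \<sigma> i" for i j
    using row[OF that(1)] \<sigma>[OF that(1)] that by blast
  have "inj_on \<sigma> {..<n}"
    by (rule inj_onI) (metis \<sigma> col lessThan_iff)
  then have "bij_betw \<sigma> {..<n} {..<n}"
    using \<sigma> unfolding bij_betw_def by (intro conjI endo_inj_surj) auto
  moreover have "P $$ (i, \<sigma> i) \<in> {1, -1}" if "i < n" for i
    using el \<sigma>[OF that] elements_matI[OF P that, of "\<sigma> i"] by blast
  moreover have "(P * A) $$ (i, j) = P $$ (i, \<sigma> i) * A $$ (\<sigma> i, j)"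
    if "A \<in> carrier_mat n m" "i < n" "j < m" for A m i j
  proof -
    have "(P * A) $$ (i, j) = (\<Sum>k<n. P $$ (i, k) * A $$ (k, j))"
      using P that by (simp add: scalar_prod_def lessThan_atLeast0)
    also have "\<dots> = (\<Sum>k<n. if k = \<sigma> i then P $$ (i, \<sigma> i) * A $$ (\<sigma> i, j) else 0)"
      using zero[OF that(2)] by (intro sum.cong) auto
    also have "\<dots> = P $$ (i, \<sigma> i) * A $$ (\<sigma> i, j)"
      using \<sigma>[OF that(2)] by simp
    finally show ?thesis .
  qed
  ultimately show ?thesis
    by (rule that[of \<sigma> "\<lambda>i. P $$ (i, \<sigma> i)"])
qed

text \<open>The transposed form of \<open>signed_permutation_mult_left\<close>.\<close>

lemma signed_permutation_mult_right:
  assumes Q: "signed_permutation_mat n Q"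
  obtains \<tau> s where "bij_betw \<tau> {..<n} {..<n}" "\<And>j. j < n \<Longrightarrow> s j \<in> {1, -1::int}"
    "\<And>A m i j. A \<in> carrier_mat m n \<Longrightarrow> i < m \<Longrightarrow> j < n \<Longrightarrow> (A * Q) $$ (i, j) = s j * A $$ (i, \<tau> j)"
proof -
  obtain \<tau> s where *: "bij_betw \<tau> {..<n} {..<n}" "\<And>j. j < n \<Longrightarrow> s j \<in> {1, -1::int}"
    "\<And>A m i j. A \<in> carrier_mat n m \<Longrightarrow> i < n \<Longrightarrow> j < m \<Longrightarrow> (transpose_mat Q * A) $$ (i, j) = s i * A $$ (\<tau> i, j)"
    by (rule signed_permutation_mult_left[OF signed_permutation_mat_transpose[OF Q]]) blast
  have Qc: "Q \<in> carrier_mat n n"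
    using Q by (simp add: signed_permutation_mat_def)
  have "(A * Q) $$ (i, j) = s j * A $$ (i, \<tau> j)"
    if "A \<in> carrier_mat m n" "i < m" "j < n" for A m i j
  proof -
    have "\<tau> j < n"
      using bij_betwE[OF *(1)] that(3) by auto
    have "(A * Q) $$ (i, j) = (transpose_mat Q * transpose_mat A) $$ (j, i)"
      unfolding transpose_mult[OF that(1) Qc, symmetric] using that Qc by simp
    also have "\<dots> = s j * transpose_mat A $$ (\<tau> j, i)"
      using that by (intro *(3)) auto
    finally show ?thesis
      using that \<open>\<tau> j < n\<close> by simp
  qed
  then show ?thesis
    using * by (intro that[of \<tau> s]) auto
qed

lemma append_rows_index:
  assumes "A \<in> carrier_mat m n" "B \<in> carrier_mat k n" "i < m + k" "j < n"
  shows "(A @\<^sub>r B) $$ (i, j) = (if i < m then A $$ (i, j) else B $$ (i - m, j))"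
  using assms by (simp add: append_rows_def)

lemma partial_hadamard_mat_append_rows:
  assumes A: "partial_hadamard_mat m n A" and B: "partial_hadamard_mat k n B"
    and orth: "\<And>a b. a < m \<Longrightarrow> b < k \<Longrightarrow> (\<Sum>j<n. A $$ (a, j) * B $$ (b, j)) = 0"
  shows "partial_hadamard_mat (m + k) n (A @\<^sub>r B)"
  unfolding partial_hadamard_mat_iff
proof (intro conjI allI impI)
  have c: "A \<in> carrier_mat m n" "B \<in> carrier_mat k n"
    using A B by (simp_all add: partial_hadamard_mat_def)
  note index = append_rows_index[OF c]
  show "A @\<^sub>r B \<in> carrier_mat (m + k) n"
    using c by (rule carrier_append_rows)
  show "(A @\<^sub>r B) $$ (a, j) \<in> {1, -1}" if "a < m + k" "j < n" for a j
  proof (cases "a < m")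
    case False
    then have "a - m < k" using that by simp
    with False show ?thesis
      using index[OF that] B that unfolding partial_hadamard_mat_iff by simp
  qed (use index[OF that] A that in \<open>simp add: partial_hadamard_mat_iff\<close>)
  have orth': "(\<Sum>j<n. B $$ (b, j) * A $$ (a, j)) = 0" if "a < m" "b < k" for a b
    using orth[OF that] by (simp add: mult.commute)
  fix a b assume ab: "a < m + k" "b < m + k"
  have "(\<Sum>j<n. (A @\<^sub>r B) $$ (a, j) * (A @\<^sub>r B) $$ (b, j))
    = (\<Sum>j<n. (if a < m then A $$ (a, j) else B $$ (a - m, j)) * (if b < m then A $$ (b, j) else B $$ (b - m, j)))"
    using index ab by simp
  also have "\<dots> = (if a = b then int n else 0)"
    using A B ab orth orth' unfolding partial_hadamard_mat_iff
    by (cases "a < m"; cases "b < m") (auto simp: less_diff_conv2)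
  finally show "(\<Sum>j<n. (A @\<^sub>r B) $$ (a, j) * (A @\<^sub>r B) $$ (b, j)) = (if a = b then int n else 0)" .
qed

lemma partial_hadamard_mat_signed_permutation_left:
  assumes H: "partial_hadamard_mat m n H" and P: "signed_permutation_mat m P"
  shows "partial_hadamard_mat m n (P * H)"
proof -
  have Hc: "H \<in> carrier_mat m n"
    using H by (simp add: partial_hadamard_mat_def)
  obtain \<sigma> s where \<sigma>: "bij_betw \<sigma> {..<m} {..<m}" and s: "\<And>i. i < m \<Longrightarrow> s i \<in> {1, -1::int}"
    and mult: "\<And>A n i j. A \<in> carrier_mat m n \<Longrightarrow> i < m \<Longrightarrow> j < n \<Longrightarrow> (P * A) $$ (i, j) = s i * A $$ (\<sigma> i, j)"
    by (rule signed_permutation_mult_left[OF P]) blast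
  note entry = mult[OF Hc]
  have \<sigma>_less: "\<sigma> a < m" if "a < m" for a
    using bij_betwE[OF \<sigma>] that by auto
  have \<sigma>_eq: "\<sigma> a = \<sigma> b \<longleftrightarrow> a = b" if "a < m" "b < m" for a b
    using \<sigma> that by (auto simp: bij_betw_def inj_on_def)
  show ?thesis
    unfolding partial_hadamard_mat_iff
  proof (intro conjI allI impI)
    show "P * H \<in> carrier_mat m n"
      using P Hc by (auto simp: signed_permutation_mat_def)
    show "(P * H) $$ (a, j) \<in> {1, -1}" if "a < m" "j < n" for a j
    proof -
      have "H $$ (\<sigma> a, j) \<in> {1, -1}"
        using H \<sigma>_less that unfolding partial_hadamard_mat_iff by blast
      with s[OF that(1)] show ?thesis
        unfolding entry[OF that] by auto
    qed
    fix a b assume ab: "a < m" "b < m"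
    have "(\<Sum>j<n. (P * H) $$ (a, j) * (P * H) $$ (b, j))
      = (\<Sum>j<n. (s a * s b) * (H $$ (\<sigma> a, j) * H $$ (\<sigma> b, j)))"
      using entry ab by (intro sum.cong) auto
    also have "\<dots> = (s a * s b) * (if \<sigma> a = \<sigma> b then int n else 0)"
      unfolding sum_distrib_left[symmetric]
      using H \<sigma>_less[OF ab(1)] \<sigma>_less[OF ab(2)] unfolding partial_hadamard_mat_iff by auto
    also have "\<dots> = (if a = b then int n else 0)"
      using s[OF ab(1)] \<sigma>_eq[OF ab] by auto
    finally show "(\<Sum>j<n. (P * H) $$ (a, j) * (P * H) $$ (b, j)) = (if a = b then int n else 0)" .
  qed
qed

text \<open>A signed permutation of the columns is an orthogonal transformation, so it preserves inner products
  of rows, even of rows of different matrices.\<close>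

lemma signed_permutation_right_gram:
  assumes A: "A \<in> carrier_mat m n" and B: "B \<in> carrier_mat k n" and Q: "signed_permutation_mat n Q"
    and ab: "a < m" "b < k"
  shows "(\<Sum>j<n. (A * Q) $$ (a, j) * (B * Q) $$ (b, j)) = (\<Sum>j<n. A $$ (a, j) * B $$ (b, j))"
proof -
  obtain \<tau> s where \<tau>: "bij_betw \<tau> {..<n} {..<n}" and s: "\<And>i. i < n \<Longrightarrow> s i \<in> {1, -1::int}"
    and mult: "\<And>A m i j. A \<in> carrier_mat m n \<Longrightarrow> i < m \<Longrightarrow> j < n \<Longrightarrow> (A * Q) $$ (i, j) = s j * A $$ (i, \<tau> j)"
    by (rule signed_permutation_mult_right[OF Q]) blast
  have sq: "s j * s j = 1" if "j < n" for j
    using s[OF that] by auto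
  have "(A * Q) $$ (a, j) * (B * Q) $$ (b, j) = A $$ (a, \<tau> j) * B $$ (b, \<tau> j)" if "j < n" for j
  proof -
    have "(A * Q) $$ (a, j) * (B * Q) $$ (b, j) = (s j * s j) * (A $$ (a, \<tau> j) * B $$ (b, \<tau> j))"
      unfolding mult[OF A ab(1) that] mult[OF B ab(2) that] by (simp only: mult_ac)
    then show ?thesis
      by (simp add: sq[OF that])
  qed
  then have "(\<Sum>j<n. (A * Q) $$ (a, j) * (B * Q) $$ (b, j)) = (\<Sum>j<n. A $$ (a, \<tau> j) * B $$ (b, \<tau> j))"
    by (intro sum.cong) auto
  also have "\<dots> = (\<Sum>j<n. A $$ (a, j) * B $$ (b, j))"
    by (rule sum.reindex_bij_betw[OF \<tau>])
  finally show ?thesis .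
qed

lemma partial_hadamard_mat_signed_permutation_right:
  assumes H: "partial_hadamard_mat m n H" and Q: "signed_permutation_mat n Q"
  shows "partial_hadamard_mat m n (H * Q)"
proof -
  have Hc: "H \<in> carrier_mat m n"
    using H by (simp add: partial_hadamard_mat_def)
  obtain \<tau> s where \<tau>: "bij_betw \<tau> {..<n} {..<n}" and s: "\<And>i. i < n \<Longrightarrow> s i \<in> {1, -1::int}"
    and mult: "\<And>A m i j. A \<in> carrier_mat m n \<Longrightarrow> i < m \<Longrightarrow> j < n \<Longrightarrow> (A * Q) $$ (i, j) = s j * A $$ (i, \<tau> j)"
    by (rule signed_permutation_mult_right[OF Q]) blast
  have "(H * Q) $$ (a, j) \<in> {1, -1}" if "a < m" "j < n" for a j
  proof -
    have "\<tau> j < n"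
      using bij_betwE[OF \<tau>] that by auto
    then have "H $$ (a, \<tau> j) \<in> {1, -1}"
      using H that unfolding partial_hadamard_mat_iff by blast
    with s[OF that(2)] show ?thesis
      unfolding mult[OF Hc that] by auto
  qed
  then show ?thesis
    using H signed_permutation_right_gram[OF Hc Hc Q] Q
    unfolding partial_hadamard_mat_iff signed_permutation_mat_def by auto
qed

section \<open>Regularizing and completing a balancedly multi-splittable matrix\<close>

lemma balanced_sign_blocks_of_mat:
  assumes p: "odd p" "3 \<le> p" and H: "partial_hadamard_mat (p\<^sup>2) (p * (p + 1)) H"
    and split: "balancedly_multi_splittable p H"
  obtains C where "disjoint_family_on C {1..p + 1}" "(\<Union>i\<in>{1..p + 1}. C i) = {..<p * (p + 1)}"
    "balanced_sign_blocks p {..<p\<^sup>2} {1..p + 1} C (\<lambda>a j. H $$ (a, j))"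
proof -
  have Hc: "H \<in> carrier_mat (p\<^sup>2) (p * (p + 1))"
    using H by (simp add: partial_hadamard_mat_def)
  then obtain C where disj: "disjoint_family_on C {1..p + 1}"
    and un: "(\<Union>i\<in>{1..p + 1}. C i) = {..<p * (p + 1)}"
    and card: "\<And>i. i \<in> {1..p + 1} \<Longrightarrow> card (C i) = p"
    and bal: "\<And>I a b. I \<subseteq> {1..p + 1} \<Longrightarrow> card I = (p + 1) div 2 \<Longrightarrow> a < p\<^sup>2 \<Longrightarrow> b < p\<^sup>2 \<Longrightarrow> a \<noteq> b \<Longrightarrow>
      (columns_submat H (\<Union>i\<in>I. C i) * transpose_mat (columns_submat H (\<Union>i\<in>I. C i))) $$ (a, b)
        \<in> {int ((p + 1) div 2), - int ((p + 1) div 2)}"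
    using split unfolding balancedly_multi_splittable_def Let_def carrier_mat_def by auto
  have fin: "finite (C i)" if "i \<in> {1..p + 1}" for i
    using card[OF that] p by (intro card_ge_0_finite) simp
  have union_sum: "(\<Sum>j\<in>(\<Union>i\<in>I. C i). f j) = (\<Sum>i\<in>I. \<Sum>j\<in>C i. f j)"
    if "I \<subseteq> {1..p + 1}" for I and f :: "nat \<Rightarrow> int"
  proof (rule sum.UNION_disjoint)
    show "finite I"
      using that finite_subset by blast
    show "\<forall>i\<in>I. finite (C i)"
      using that fin by blast
    show "\<forall>i\<in>I. \<forall>j\<in>I. i \<noteq> j \<longrightarrow> C i \<inter> C j = {}"
      using that disj unfolding disjoint_family_on_def by blast
  qed
  have "balanced_sign_blocks p {..<p\<^sup>2} {1..p + 1} C (\<lambda>a j. H $$ (a, j))"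
  proof unfold_locales
    fix a i j assume "a \<in> {..<p\<^sup>2}" "i \<in> {1..p + 1}" "j \<in> C i"
    moreover from this have "j < p * (p + 1)"
      using un by blast
    ultimately show "H $$ (a, j) \<in> {1, -1}"
      using H unfolding partial_hadamard_mat_iff by simp
  next
    fix a b assume ab: "a \<in> {..<p\<^sup>2}" "b \<in> {..<p\<^sup>2}" "a \<noteq> b"
    then have "(\<Sum>j<p * (p + 1). H $$ (a, j) * H $$ (b, j)) = 0"
      using H unfolding partial_hadamard_mat_iff by simp
    then show "(\<Sum>i\<in>{1..p + 1}. block_inner C (\<lambda>a j. H $$ (a, j)) i a b) = 0"
      unfolding block_inner_def union_sum[OF subset_refl, symmetric] un .
  next
    fix a b I assume ab: "a \<in> {..<p\<^sup>2}" "b \<in> {..<p\<^sup>2}" "a \<noteq> b"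
      and I: "I \<subseteq> {1..p + 1}" "card I = (p + 1) div 2"
    have "(\<Union>i\<in>I. C i) \<subseteq> {..<p * (p + 1)}"
      using I(1) un by blast
    then show "(\<Sum>i\<in>I. block_inner C (\<lambda>a j. H $$ (a, j)) i a b)
        \<in> {int ((p + 1) div 2), - int ((p + 1) div 2)}"
      using bal[OF I] ab columns_submat_gram[OF Hc] union_sum[OF I(1)]
      by (simp add: block_inner_def)
  qed (use p card in auto)
  with disj un show ?thesis
    by (rule that)
qed


text \<open>The combinatorial results for the blocks \<open>C i\<close>, reassembled over all columns. The signs \<open>e\<close>
  and \<open>v\<close> make \<open>H\<close> regular. The matrix \<open>M\<close> has the entry \<open>N k i * v j\<close> in a column \<open>j\<close> of the block
  \<open>i\<close>; as each row of \<open>H\<close>, weighted with \<open>v\<close>, has the same sum \<open>e a\<close> in all blocks, its inner product with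
  the row \<open>k\<close> of \<open>M\<close> is \<open>e a\<close> times the sum of \<open>N k\<close>, which is \<open>0\<close>.\<close>

lemma regularizing_signs_and_companion:
  assumes p: "odd p" "3 \<le> p" and H: "partial_hadamard_mat (p\<^sup>2) (p * (p + 1)) H"
    and split: "balancedly_multi_splittable p H"
  obtains e v M where
    "\<And>a. a < p\<^sup>2 \<Longrightarrow> e a \<in> {1, -1::int}"
    "\<And>j. j < p * (p + 1) \<Longrightarrow> v j \<in> {1, -1::int}"
    "\<And>a. a < p\<^sup>2 \<Longrightarrow> (\<Sum>j<p * (p + 1). e a * H $$ (a, j) * v j) = int p + 1"
    "\<And>j. j < p * (p + 1) \<Longrightarrow> (\<Sum>a<p\<^sup>2. e a * H $$ (a, j) * v j) = int p"
    "partial_hadamard_mat p (p * (p + 1)) M"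
    "\<And>a k. a < p\<^sup>2 \<Longrightarrow> k < p \<Longrightarrow> (\<Sum>j<p * (p + 1). H $$ (a, j) * M $$ (k, j)) = 0"
proof -
  let ?n = "p * (p + 1)" and ?B = "{1..p + 1}"
  obtain C where disj: "disjoint_family_on C ?B" and un: "(\<Union>i\<in>?B. C i) = {..<?n}"
    and bal: "balanced_sign_blocks p {..<p\<^sup>2} ?B C (\<lambda>a j. H $$ (a, j))"
    by (rule balanced_sign_blocks_of_mat[OF assms]) blast
  interpret balanced_sign_blocks p "{..<p\<^sup>2}" ?B C "\<lambda>a j. H $$ (a, j)"
    by (rule bal)
  \<comment> \<open>Row 0 only serves as the reference row for the signs.\<close>
  define e where "e a = pair_sign a 0" for a
  have e: "e a \<in> {1, -1}" for a
    unfolding e_def by (rule pair_sign_values)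
  interpret N: normalized_sign_blocks p "{..<p\<^sup>2}" ?B C "\<lambda>a j. e a * H $$ (a, j)"
    unfolding e_def by (rule normalization) (use p in simp)
  let ?v = N.column_sign
  have blocks: "(\<Sum>j<?n. f j) = (\<Sum>i\<in>?B. \<Sum>j\<in>C i. f j)" for f :: "nat \<Rightarrow> int"
    unfolding un[symmetric] using finite_block disj
    by (intro sum.UNION_disjoint) (auto simp: disjoint_family_on_def)
  have in_block: "\<exists>i. i \<in> ?B \<and> j \<in> C i" if "j < ?n" for j
    using un that by blast
  have v: "?v j \<in> {1, -1}" if "j < ?n" for j
    using in_block[OF that] N.column_sign_values by blast
  have row: "(\<Sum>j<?n. e a * H $$ (a, j) * ?v j) = int p + 1" if "a < p\<^sup>2" for a
    unfolding blocks using N.block_row_sum that by simp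
  have column: "(\<Sum>a<p\<^sup>2. e a * H $$ (a, j) * ?v j) = int p" if j: "j < ?n" for j
  proof -
    obtain i where i: "i \<in> ?B" "j \<in> C i"
      using in_block[OF j] by blast
    have "(\<Sum>a<p\<^sup>2. e a * H $$ (a, j) * ?v j) = N.column_sum j * ?v j"
      by (simp add: N.column_sum_def sum_distrib_right)
    also have "\<dots> = int p * (?v j * ?v j)"
      by (simp add: N.column_sum_sign[OF i])
    also have "\<dots> = int p"
      using v[OF j] by auto
    finally show ?thesis .
  qed
  obtain N :: "nat \<Rightarrow> nat \<Rightarrow> int" where N: "\<And>k i. k < p \<Longrightarrow> i \<in> ?B \<Longrightarrow> N k i \<in> {1, -1}"
    "\<And>k. k < p \<Longrightarrow> (\<Sum>i\<in>?B. N k i) = 0"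
    "\<And>k l. k < p \<Longrightarrow> l < p \<Longrightarrow> (\<Sum>i\<in>?B. N k i * N l i) = (if k = l then int p + 1 else 0)"
    by (rule N.companion_rows) blast
  define blk where "blk j = (THE i. i \<in> ?B \<and> j \<in> C i)" for j
  have blk: "blk j = i" if "i \<in> ?B" "j \<in> C i" for i j
    unfolding blk_def using that disj by (intro the_equality) (unfold disjoint_family_on_def, blast+)
  define M where "M = mat p ?n (\<lambda>(k, j). N k (blk j) * ?v j)"
  have M_index: "M $$ (k, j) = N k i * ?v j" if "k < p" "i \<in> ?B" "j \<in> C i" for k i j
  proof -
    have "j < ?n"
      using un that by blast
    then show ?thesis
      using that(1) blk[OF that(2,3)] by (simp add: M_def)
  qed
  have "partial_hadamard_mat p ?n M"
    unfolding partial_hadamard_mat_iff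
  proof (intro conjI allI impI)
    show "M \<in> carrier_mat p ?n"
      by (simp add: M_def)
    show "M $$ (k, j) \<in> {1, -1}" if k: "k < p" and j: "j < ?n" for k j
    proof -
      obtain i where i: "i \<in> ?B" "j \<in> C i"
        using in_block[OF j] by blast
      show ?thesis
        unfolding M_index[OF k i] using N(1)[OF k i(1)] v[OF j] by auto
    qed
    fix k l assume kl: "k < p" "l < p"
    have "(\<Sum>j\<in>C i. M $$ (k, j) * M $$ (l, j)) = int p * (N k i * N l i)" if i: "i \<in> ?B" for i
    proof -
      have "M $$ (k, j) * M $$ (l, j) = N k i * N l i" if j: "j \<in> C i" for j
        unfolding M_index[OF kl(1) i j] M_index[OF kl(2) i j]
        using N.column_sign_values[OF i j] by auto
      then show ?thesis
        using card_block[OF i] by simp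
    qed
    then show "(\<Sum>j<?n. M $$ (k, j) * M $$ (l, j)) = (if k = l then int ?n else 0)"
      unfolding blocks using N(3)[OF kl] by (simp add: algebra_simps flip: sum_distrib_left)
  qed
  moreover have "(\<Sum>j<?n. H $$ (a, j) * M $$ (k, j)) = 0" if a: "a < p\<^sup>2" and k: "k < p" for a k
  proof -
    have "e a * (\<Sum>j\<in>C i. H $$ (a, j) * M $$ (k, j)) = N k i" if i: "i \<in> ?B" for i
    proof -
      have "e a * (\<Sum>j\<in>C i. H $$ (a, j) * M $$ (k, j)) = N k i * (\<Sum>j\<in>C i. e a * H $$ (a, j) * ?v j)"
        unfolding sum_distrib_left by (intro sum.cong refl) (simp add: M_index[OF k i] mult_ac)
      then show ?thesis
        using N.block_row_sum[OF _ i, of a] a by simp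
    qed
    then have "e a * (\<Sum>j<?n. H $$ (a, j) * M $$ (k, j)) = 0"
      unfolding blocks sum_distrib_left[of "e a" _ ?B] using N(2)[OF k] by simp
    then show ?thesis
      using e[of a] by auto
  qed
  ultimately show ?thesis
    using that[of e ?v M] e v row column by blast
qed

theorem theorem2p2:
  fixes p :: nat and H :: "int mat"
  assumes "p > 0" and "[p = 3] (mod 4)"
    and "partial_hadamard_mat (p^2) (p * (p + 1)) H"
    and "balancedly_multi_splittable p H"
  shows "(\<exists>P Q. signed_permutation_mat (p^2) P \<and> signed_permutation_mat (p * (p + 1)) Q \<and>
            row_regular (P * H * Q) \<and> column_regular (P * H * Q)) \<and>
         (\<forall>P Q. signed_permutation_mat (p^2) P \<and> signed_permutation_mat (p * (p + 1)) Q \<and>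
            row_regular (P * H * Q) \<and> column_regular (P * H * Q) \<longrightarrow>
            embeddable_in_hadamard p (P * H * Q))"
proof -
  let ?m = "p\<^sup>2" and ?n = "p * (p + 1)"
  have "p mod 4 = 3"
    using assms(2) by (simp add: cong_def)
  then have "odd p" "3 \<le> p"
    by presburger+
  note H = assms(3)
  have Hc: "H \<in> carrier_mat ?m ?n"
    using H by (simp add: partial_hadamard_mat_def)
  obtain e v M where e: "\<And>a. a < ?m \<Longrightarrow> e a \<in> {1, -1::int}"
    and v: "\<And>j. j < ?n \<Longrightarrow> v j \<in> {1, -1::int}"
    and row: "\<And>a. a < ?m \<Longrightarrow> (\<Sum>j<?n. e a * H $$ (a, j) * v j) = int p + 1"
    and column: "\<And>j. j < ?n \<Longrightarrow> (\<Sum>a<?m. e a * H $$ (a, j) * v j) = int p"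
    and M: "partial_hadamard_mat p ?n M"
    and orth: "\<And>a k. a < ?m \<Longrightarrow> k < p \<Longrightarrow> (\<Sum>j<?n. H $$ (a, j) * M $$ (k, j)) = 0"
    by (rule regularizing_signs_and_companion[OF \<open>odd p\<close> \<open>3 \<le> p\<close> assms(3,4)]) blast
  let ?P = "mat_diag ?m e" and ?Q = "mat_diag ?n v"
  have PH: "?P * H = mat ?m ?n (\<lambda>(i, j). e i * H $$ (i, j))"
    by (rule mat_diag_mult_left[OF Hc])
  have PHQ: "?P * H * ?Q = mat ?m ?n (\<lambda>(i, j). e i * H $$ (i, j) * v j)"
    unfolding PH by (subst mat_diag_mult_right) auto
  have "row_regular (?P * H * ?Q)"
    unfolding row_regular_def PHQ using row by (intro exI[of _ "int p + 1"]) simp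
  moreover have "column_regular (?P * H * ?Q)"
    unfolding column_regular_def PHQ using column by (intro exI[of _ "int p"]) simp
  moreover have "signed_permutation_mat ?m ?P" "signed_permutation_mat ?n ?Q"
    using e v by (simp_all add: signed_permutation_mat_diag)
  moreover have "embeddable_in_hadamard p (P * H * Q)"
    if P: "signed_permutation_mat ?m P" and Q: "signed_permutation_mat ?n Q" for P Q
  proof -
    have Mc: "M \<in> carrier_mat p ?n" and PHc: "P * H \<in> carrier_mat ?m ?n" and Qc: "Q \<in> carrier_mat ?n ?n"
      using M P Q Hc by (auto simp: partial_hadamard_mat_def signed_permutation_mat_def)
    obtain \<sigma> s where \<sigma>: "bij_betw \<sigma> {..<?m} {..<?m}"
      and mult: "\<And>A n i j. A \<in> carrier_mat ?m n \<Longrightarrow> i < ?m \<Longrightarrow> j < n \<Longrightarrow> (P * A) $$ (i, j) = s i * A $$ (\<sigma> i, j)"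
      by (rule signed_permutation_mult_left[OF P]) blast
    have "(\<Sum>j<?n. (P * H) $$ (a, j) * M $$ (k, j)) = 0" if "a < ?m" "k < p" for a k
    proof -
      have "\<sigma> a < ?m"
        using bij_betwE[OF \<sigma>] that by auto
      have "(\<Sum>j<?n. (P * H) $$ (a, j) * M $$ (k, j)) = s a * (\<Sum>j<?n. H $$ (\<sigma> a, j) * M $$ (k, j))"
        unfolding sum_distrib_left using mult[OF Hc that(1)] by (intro sum.cong) (auto simp: mult.assoc)
      then show ?thesis
        using orth[OF \<open>\<sigma> a < ?m\<close> that(2)] by simp
    qed
    then have "(\<Sum>j<?n. (P * H * Q) $$ (a, j) * (M * Q) $$ (k, j)) = 0" if "a < ?m" "k < p" for a k
      using signed_permutation_right_gram[OF PHc Mc Q that] that by simp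
    then have "partial_hadamard_mat (?m + p) ?n ((P * H * Q) @\<^sub>r (M * Q))"
      using H M P Q
      by (intro partial_hadamard_mat_append_rows partial_hadamard_mat_signed_permutation_right
          partial_hadamard_mat_signed_permutation_left)
    moreover have "?m + p = ?n"
      by (simp add: power2_eq_square)
    moreover have "M * Q \<in> carrier_mat p ?n"
      using Mc Qc by simp
    ultimately show ?thesis
      unfolding embeddable_in_hadamard_def by metis
  qed
  ultimately show ?thesis
    by blast
qed

end
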